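(* For all integers $N,k,n\geqslant 0$, $$\sum_{j=0}^{\lfloor k/4 \rfloor} \overline{p}_4\Bigg( N,\;N+1-k+4j,\;j,\;k-4j,\;n-\binom{k-4j}{2}\Bigg) =\sum_{j=0}^{\lfloor k/2 \rfloor} (-1)^j\, \overline{p}_2\left( N,\,N,\,j,\,k-2j,\,n\right).$$
   Context: Assume there are positive integers of two kinds, $\lambda$ (first kind) and $\overline{\lambda}$ (second kind). For an integer $r\geqslant 1$ and integers $N_1,N_2,k_1,k_2,n\geqslant 0$, $\overline{p}_r(N_1,N_2,k_1,k_2,n)$ denotes the number of partitions of $n$ into parts of two kinds with at most $k_1$ parts of the first kind, each divisible by $r$ and less than or equal to $N_1r$, and at most $k_2$ parts of the second kind, each less than or equal to $N_2$ (the order of the parts is irrelevant; the empty partition is the unique partition of $0$). For example $\overline{p}_2(2,3,2,2,4)=6$, the partitions being $4$, $2+2$, $2+\overline{2}$, $2+\overline{1}+\overline{1}$, $\overline{3}+\overline{1}$, $\overline{2}+\overline{2}$. Convention: $\overline{p}_r(N_1,N_2,k_1,k_2,n)=0$ whenever any of $N_1,N_2,k_1,k_2,n$ is negative. Also $\binom{m}{2}=m(m-1)/2$. *)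

theory Defs
  imports Complex_Main "HOL-Library.Multiset"
begin

text \<open>
  A partition into parts of two kinds is a pair \<open>(A, B)\<close> of multisets of positive integers:
  \<open>A\<close> holds the parts of the first kind, \<open>B\<close> those of the second kind.
\<close>

definition two_kind_partitions ::
  "nat \<Rightarrow> nat \<Rightarrow> nat \<Rightarrow> nat \<Rightarrow> nat \<Rightarrow> nat \<Rightarrow> (nat multiset \<times> nat multiset) set" where
  "two_kind_partitions r N1 N2 k1 k2 n =
     {(A, B).
        (\<forall>a \<in># A. 0 < a \<and> r dvd a \<and> a \<le> N1 * r) \<and> size A \<le> k1 \<and>
        (\<forall>b \<in># B. 0 < b \<and> b \<le> N2) \<and> size B \<le> k2 \<and>
        sum_mset A + sum_mset B = n}"

text \<open>
  The arguments are integers because the count is set to \<open>0\<close> when one of them is negative. The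
  case distinction is needed: for negative \<open>N1\<close> or \<open>N2\<close> the bounds on the parts alone would still
  admit the empty multiset.
\<close>

definition pbar :: "nat \<Rightarrow> int \<Rightarrow> int \<Rightarrow> int \<Rightarrow> int \<Rightarrow> int \<Rightarrow> nat" where
  "pbar r N1 N2 k1 k2 n =
     (if N1 < 0 \<or> N2 < 0 \<or> k1 < 0 \<or> k2 < 0 \<or> n < 0 then 0
      else card (two_kind_partitions r (nat N1) (nat N2) (nat k1) (nat k2) (nat n)))"

lemma finite_two_kind_partitions: "finite (two_kind_partitions r N1 N2 k1 k2 n)"
proof -
  let ?M = "\<lambda>N k. {M :: nat multiset. set_mset M \<subseteq> {..N} \<and> size M \<le> k}"
  have fin: "finite (?M N k)" for N k
  proof (rule finite_subset)
    show "?M N k \<subseteq> mset ` {xs. set xs \<subseteq> {..N} \<and> length xs \<le> k}"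
    proof
      fix M assume "M \<in> ?M N k"
      moreover obtain xs where "M = mset xs" by (metis ex_mset)
      ultimately show "M \<in> mset ` {xs. set xs \<subseteq> {..N} \<and> length xs \<le> k}" by auto
    qed
    show "finite (mset ` {xs. set xs \<subseteq> {..N} \<and> length xs \<le> k})"
      by (intro finite_imageI finite_lists_length_le) simp
  qed
  have "two_kind_partitions r N1 N2 k1 k2 n \<subseteq> ?M (N1 * r) k1 \<times> ?M N2 k2"
    by (auto simp: two_kind_partitions_def)
  then show ?thesis
    by (rule finite_subset) (intro finite_cartesian_product fin)
qed

end

theory Submission
  imports Defs "HOL-Computational_Algebra.Formal_Power_Series"
    "HOL-Computational_Algebra.Polynomial"
begin

text \<open>
  Let \<open>q\<close> mark the number being partitioned. Partitions into at most \<open>m\<close> parts of size at most \<open>M\<close>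
  are counted by the Gaussian binomial \<open>[M + m, m]\<^sub>q\<close>, so by the two \<open>q\<close>-binomial theorems the
  left-hand side is the coefficient of \<open>z\<^sup>k q\<^sup>n\<close> in
  \<open>\<Prod>\<^bsub>i \<le> N\<^esub> (1 + z q\<^sup>i) / (1 - z\<^sup>4 q\<^bsup>4i\<^esup>)\<close>, and the right-hand side is the same coefficient of
  \<open>\<Prod>\<^bsub>i \<le> N\<^esub> 1 / ((1 + z\<^sup>2 q\<^bsup>2i\<^esup>) (1 - z q\<^sup>i))\<close>. The two products agree factor by factor.
\<close>

section \<open>Generating polynomials for partitions in a box\<close>

definition box_partitions :: "nat \<Rightarrow> nat \<Rightarrow> nat multiset set" where
  "box_partitions N k = {M. set_mset M \<subseteq> {1..N} \<and> size M \<le> k}"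

text \<open>The Gaussian binomial of \<open>N + k\<close> over \<open>k\<close>, taken at
  \<open>q^r\<close>. Summing over the partitions themselves avoids any division by
  \<open>q\<close>-factorials.\<close>

definition gauss_poly :: "nat \<Rightarrow> nat \<Rightarrow> nat \<Rightarrow> int poly" where
  "gauss_poly r N k = (\<Sum>M\<in>box_partitions N k. monom 1 (r * sum_mset M))"

lemma finite_box_partitions: "finite (box_partitions N k)"
proof (rule finite_subset)
  show "box_partitions N k \<subseteq> mset ` {xs. set xs \<subseteq> {1..N} \<and> length xs \<le> k}"
  proof
    fix M assume "M \<in> box_partitions N k"
    moreover obtain xs where "M = mset xs" by (metis ex_mset)
    ultimately show "M \<in> mset ` {xs. set xs \<subseteq> {1..N} \<and> length xs \<le> k}"
      by (auto simp: box_partitions_def)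
  qed
  show "finite (mset ` {xs. set xs \<subseteq> {1..N} \<and> length xs \<le> k})"
    by (intro finite_imageI finite_lists_length_le) simp
qed

lemma box_partitions_0_left: "box_partitions 0 k = {{#}}"
  by (auto simp: box_partitions_def)

lemma box_partitions_0_right: "box_partitions N 0 = {{#}}"
  by (auto simp: box_partitions_def)

text \<open>Split by whether the largest admissible part \<open>Suc N\<close> occurs; if it does,
  one copy is removed, which leaves room for \<open>k\<close> parts.\<close>

lemma box_partitions_Suc_Suc:
  "box_partitions (Suc N) (Suc k) =
     box_partitions N (Suc k) \<union> add_mset (Suc N) ` box_partitions (Suc N) k"
proof (intro equalityI subsetI)
  fix M assume M: "M \<in> box_partitions (Suc N) (Suc k)"
  show "M \<in> box_partitions N (Suc k) \<union> add_mset (Suc N) ` box_partitions (Suc N) k"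
  proof (cases "Suc N \<in># M")
    case True
    then obtain M' where "M = add_mset (Suc N) M'" by (metis mset_add)
    then show ?thesis using M by (auto simp: box_partitions_def)
  next
    case False
    have "a \<le> N" if "a \<in># M" for a
      using that M False by (metis (no_types, lifting) atLeastAtMost_iff box_partitions_def
          le_Suc_eq mem_Collect_eq subsetD)
    then show ?thesis using M by (auto simp: box_partitions_def)
  qed
qed (fastforce simp: box_partitions_def)

lemma gauss_poly_0_left: "gauss_poly r 0 k = 1"
  by (simp add: gauss_poly_def box_partitions_0_left)

lemma gauss_poly_0_right: "gauss_poly r N 0 = 1"
  by (simp add: gauss_poly_def box_partitions_0_right)

text \<open>The \<open>q\<close>-Pascal rule: the removed part \<open>Suc N\<close> accounts for the
  monomial.\<close>

lemma gauss_poly_Suc_Suc: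
  "gauss_poly r (Suc N) (Suc k) =
     gauss_poly r N (Suc k) + monom 1 (r * Suc N) * gauss_poly r (Suc N) k"
proof -
  have "box_partitions N (Suc k) \<inter> add_mset (Suc N) ` box_partitions (Suc N) k = {}"
    by (auto simp: box_partitions_def)
  moreover have "inj_on (add_mset (Suc N)) (box_partitions (Suc N) k)"
    by (auto simp: inj_on_def)
  ultimately show ?thesis
    by (simp add: gauss_poly_def box_partitions_Suc_Suc sum.union_disjoint finite_box_partitions
        sum.reindex sum_distrib_left mult_monom algebra_simps)
qed

text \<open>Dividing each part of the first kind by \<open>r\<close> turns the pair into two
  independent box partitions, so the generating polynomials multiply.\<close>

lemma card_two_kind_partitions:
  assumes "r > 0"
  shows "int (card (two_kind_partitions r N1 N2 k1 k2 n)) =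
           coeff (gauss_poly r N1 k1 * gauss_poly 1 N2 k2) n"
proof -
  let ?B = "box_partitions N1 k1 \<times> box_partitions N2 k2"
  let ?S = "{(A, B) \<in> ?B. r * sum_mset A + sum_mset B = n}"
  have "bij_betw (map_prod (image_mset ((*) r)) id) ?S (two_kind_partitions r N1 N2 k1 k2 n)"
  proof (rule bij_betw_byWitness[where f' = "map_prod (image_mset (\<lambda>a. a div r)) id"])
    show "\<forall>p\<in>?S. map_prod (image_mset (\<lambda>a. a div r)) id (map_prod (image_mset ((*) r)) id p) = p"
      using assms by (auto simp: image_mset.compositionality comp_def)
    have scale: "image_mset ((*) r) (image_mset (\<lambda>a. a div r) A) = A"
      if "\<forall>a\<in>#A. 0 < a \<and> r dvd a \<and> a \<le> N1 * r" for A
    proof -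
      have "image_mset ((*) r) (image_mset (\<lambda>a. a div r) A) = image_mset (\<lambda>a. a) A"
        unfolding image_mset.compositionality comp_def using that
        by (intro image_mset_cong) auto
      then show ?thesis by simp
    qed
    then show "\<forall>p\<in>two_kind_partitions r N1 N2 k1 k2 n.
        map_prod (image_mset ((*) r)) id (map_prod (image_mset (\<lambda>a. a div r)) id p) = p"
      by (auto simp: two_kind_partitions_def)
    have sum_scale: "r * sum_mset A = sum_mset (image_mset ((*) r) A)" for A
      by (induction A) (simp_all add: distrib_left)
    show "map_prod (image_mset ((*) r)) id ` ?S \<subseteq> two_kind_partitions r N1 N2 k1 k2 n"
      using assms
      by (fastforce simp: two_kind_partitions_def box_partitions_def sum_scale mult.commute)
    show "map_prod (image_mset (\<lambda>a. a div r)) id ` two_kind_partitions r N1 N2 k1 k2 n \<subseteq> ?S"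
    proof (rule image_subsetI)
      fix p assume "p \<in> two_kind_partitions r N1 N2 k1 k2 n"
      moreover obtain A B where p: "p = (A, B)" by (cases p)
      ultimately have AB: "(A, B) \<in> two_kind_partitions r N1 N2 k1 k2 n" by simp
      then have A: "\<forall>a\<in>#A. 0 < a \<and> r dvd a \<and> a \<le> N1 * r"
        by (auto simp: two_kind_partitions_def)
      have "1 \<le> a div r \<and> a div r \<le> N1" if "a \<in># A" for a
      proof -
        from A that have "r dvd a" by blast
        then obtain b where "a = r * b" ..
        then show ?thesis using A that assms by (auto simp: mult.commute[of r])
      qed
      then have "image_mset (\<lambda>a. a div r) A \<in> box_partitions N1 k1"
        using AB unfolding two_kind_partitions_def box_partitions_def by force
      moreover have "B \<in> box_partitions N2 k2"
        using AB unfolding two_kind_partitions_def box_partitions_def by (auto simp: Suc_le_eq)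
      moreover have "r * sum_mset (image_mset (\<lambda>a. a div r) A) + sum_mset B = n"
        unfolding sum_scale scale[OF A] using AB by (simp add: two_kind_partitions_def)
      ultimately show "map_prod (image_mset (\<lambda>a. a div r)) id p \<in> ?S"
        by (simp add: p)
    qed
  qed
  then have card_eq: "card ?S = card (two_kind_partitions r N1 N2 k1 k2 n)"
    by (rule bij_betw_same_card)
  have "gauss_poly r N1 k1 * gauss_poly 1 N2 k2 =
      (\<Sum>(A, B)\<in>?B. monom 1 (r * sum_mset A + sum_mset B))"
    by (simp add: gauss_poly_def sum_product sum.cartesian_product mult_monom)
  then have "coeff (gauss_poly r N1 k1 * gauss_poly 1 N2 k2) n =
      (\<Sum>p\<in>?B. if r * sum_mset (fst p) + sum_mset (snd p) = n then 1 else 0)"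
    by (simp add: coeff_sum case_prod_beta)
  also have "\<dots> = int (card {p \<in> ?B. r * sum_mset (fst p) + sum_mset (snd p) = n})"
    by (simp add: finite_box_partitions flip: sum.inter_filter)
  also have "{p \<in> ?B. r * sum_mset (fst p) + sum_mset (snd p) = n} = ?S" by auto
  finally show ?thesis by (simp only: card_eq)
qed

lemma pbar_of_nat:
  assumes "r > 0"
  shows "int (pbar r (int N1) (int N2) (int k1) (int k2) (int n)) =
           coeff (gauss_poly r N1 k1 * gauss_poly 1 N2 k2) n"
  using card_two_kind_partitions[OF assms] by (simp add: pbar_def)

section \<open>The second \<open>q\<close>-binomial theorem\<close>

text \<open>A series in \<open>z\<close> (here \<open>fps_X\<close>) over polynomials in
  \<open>q\<close>. The index \<open>d\<close> replaces \<open>z\<close> by \<open>z^d\<close>, and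
  \<open>c = - 1\<close> produces the alternating sign of the right-hand side.\<close>

definition gauss_fps :: "nat \<Rightarrow> int \<Rightarrow> nat \<Rightarrow> nat \<Rightarrow> int poly fps" where
  "gauss_fps d c r N =
     Abs_fps (\<lambda>n. if d dvd n then smult (c ^ (n div d)) (gauss_poly r N (n div d)) else 0)"

text \<open>Reduces the functional equations below to recursions between coefficients.\<close>

lemma fps_eq_plus_const_X_power_mult_iff:
  fixes f g :: "'a::comm_ring_1 fps"
  shows "g = f + fps_const a * fps_X ^ d * g \<longleftrightarrow>
    (\<forall>n. fps_nth g n = fps_nth f n + (if n < d then 0 else a * fps_nth g (n - d)))"
  by (auto simp: fps_eq_iff mult.assoc fps_X_power_mult_nth)

lemma gauss_fps_0:
  assumes "d > 0"
  shows "gauss_fps d c r 0 = 1 + fps_const (monom c 0) * fps_X ^ d * gauss_fps d c r 0"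
  unfolding fps_eq_plus_const_X_power_mult_iff
proof
  fix n
  show "fps_nth (gauss_fps d c r 0) n = fps_nth 1 n +
      (if n < d then 0 else monom c 0 * fps_nth (gauss_fps d c r 0) (n - d))"
  proof (cases "d dvd n")
    case True
    then obtain k where "n = d * k" ..
    then show ?thesis using assms
      by (cases k) (auto simp: gauss_fps_def gauss_poly_0_left monom_0 mult.commute)
  next
    case False
    then have "\<not> d dvd n - d" if "\<not> n < d" using that by (simp add: dvd_minus_self)
    then show ?thesis using False by (cases "n = 0") (auto simp: gauss_fps_def)
  qed
qed

text \<open>The \<open>q\<close>-Pascal rule at each multiple of \<open>d\<close>; at other
  exponents all terms vanish. Passing from \<open>N\<close> to \<open>Suc N\<close> thus divides by
  one more factor.\<close>

lemma gauss_fps_Suc: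
  assumes "d > 0"
  shows "gauss_fps d c r (Suc N) = gauss_fps d c r N +
           fps_const (monom c (r * Suc N)) * fps_X ^ d * gauss_fps d c r (Suc N)"
  unfolding fps_eq_plus_const_X_power_mult_iff
proof
  fix n
  have monom_c: "monom c (r * Suc N) = smult c (monom 1 (r * Suc N))"
    by (simp add: smult_monom)
  show "fps_nth (gauss_fps d c r (Suc N)) n = fps_nth (gauss_fps d c r N) n +
      (if n < d then 0
       else monom c (r * Suc N) * fps_nth (gauss_fps d c r (Suc N)) (n - d))"
  proof (cases "d dvd n")
    case True
    then obtain k where "n = d * k" ..
    then show ?thesis using assms
      by (cases k) (auto simp: gauss_fps_def gauss_poly_0_right gauss_poly_Suc_Suc monom_c
          smult_add_right mult_Suc_right[of d] mult.commute[of _ c] simp del: mult_Suc mult_Suc_right)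
  next
    case False
    then have "\<not> d dvd n - d" if "\<not> n < d" using that by (simp add: dvd_minus_self)
    then show ?thesis using False by (auto simp: gauss_fps_def)
  qed
qed

text \<open>The functional equations telescope. The result is stated as an inverse because
  \<open>int poly\<close> is not a field.\<close>

lemma gauss_fps_mult_prod:
  assumes "d > 0"
  shows "gauss_fps d c r N * (\<Prod>i\<le>N. 1 - fps_const (monom c (r * i)) * fps_X ^ d) = 1"
proof (induction N)
  case 0
  then show ?case using gauss_fps_0[OF assms, of c r] by (simp add: algebra_simps)
next
  case (Suc N)
  have "gauss_fps d c r (Suc N) * (1 - fps_const (monom c (r * Suc N)) * fps_X ^ d) =
      gauss_fps d c r N"
    using gauss_fps_Suc[OF assms, of c r N] by (simp add: algebra_simps)
  then have "(gauss_fps d c r (Suc N) * (1 - fps_const (monom c (r * Suc N)) * fps_X ^ d)) *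
      (\<Prod>i\<le>N. 1 - fps_const (monom c (r * i)) * fps_X ^ d) = 1"
    by (simp only: Suc.IH)
  then show ?case by (simp only: prod.atMost_Suc ac_simps)
qed

section \<open>The first \<open>q\<close>-binomial theorem and comparison of the products\<close>

text \<open>
  The coefficient of \<open>z\<^sup>m\<close> in \<open>\<Prod>\<^bsub>i < M\<^esub> (1 + z q\<^sup>i)\<close>; the truncated \<open>M - m\<close> would give \<open>1\<close>
  instead of \<open>0\<close> for the Gaussian binomial when \<open>m > M\<close>, hence the case distinction.
\<close>

definition elem_poly :: "nat \<Rightarrow> nat \<Rightarrow> int poly" where
  "elem_poly M m = (if m \<le> M then monom 1 (m choose 2) * gauss_poly 1 (M - m) m else 0)"

text \<open>Compares coefficients after multiplication by the factor
  \<open>1 + z q^M\<close>.\<close>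

lemma elem_poly_Suc_Suc:
  "elem_poly (Suc M) (Suc m) = elem_poly M (Suc m) + monom 1 M * elem_poly M m"
proof -
  have choose: "Suc m choose 2 = m + (m choose 2)"
    by (simp add: numeral_2_eq_2)
  \<comment> \<open>For \<open>M < m\<close> everything is zero, and for \<open>M = m\<close> the
    first summand is. Otherwise \<open>M + (m choose 2) = (Suc m choose 2) + Suc l\<close>, which
    reduces the claim to the \<open>q\<close>-Pascal rule.\<close>
  consider "M < m" | "M = m" | l where "M = m + Suc l"
    by (metis less_imp_Suc_add linorder_neqE_nat add_Suc_right)
  then show ?thesis
  proof cases
    case 3
    then have "monom 1 M * elem_poly M m =
        (monom 1 M * monom 1 (m choose 2)) * gauss_poly 1 (Suc l) m"
      by (simp add: elem_poly_def mult.assoc)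
    also have "monom 1 M * monom 1 (m choose 2) =
        (monom 1 (Suc m choose 2) * monom 1 (Suc l) :: int poly)"
      unfolding mult_monom choose 3 by (simp add: add_ac)
    finally have "monom 1 M * elem_poly M m =
        monom 1 (Suc m choose 2) * monom 1 (Suc l) * gauss_poly 1 (Suc l) m" .
    then show ?thesis
      unfolding elem_poly_def[of _ "Suc m"] using 3
      by (simp add: gauss_poly_Suc_Suc distrib_left mult.assoc)
  qed (auto simp: elem_poly_def gauss_poly_0_left choose mult_monom)
qed

lemma Abs_fps_elem_poly:
  "Abs_fps (elem_poly M) = (\<Prod>i<M. 1 + fps_const (monom 1 i) * fps_X)"
proof (induction M)
  case 0
  show ?case
    by (auto simp: fps_eq_iff elem_poly_def gauss_poly_0_left binomial_eq_0)
next
  case (Suc M)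
  have "Abs_fps (elem_poly (Suc M)) =
      Abs_fps (elem_poly M) + fps_const (monom 1 M) * (fps_X * Abs_fps (elem_poly M))"
  proof (rule fps_ext)
    fix n
    show "fps_nth (Abs_fps (elem_poly (Suc M))) n = fps_nth (Abs_fps (elem_poly M) +
        fps_const (monom 1 M) * (fps_X * Abs_fps (elem_poly M))) n"
      by (cases n) (simp_all add: elem_poly_Suc_Suc, simp add: elem_poly_def gauss_poly_0_right)
  qed
  then show ?case by (simp add: Suc.IH algebra_simps)
qed

lemma elem_fps_mult_gauss_fps:
  "gauss_fps 4 1 4 N * Abs_fps (elem_poly (Suc N)) = gauss_fps 2 (- 1) 2 N * gauss_fps 1 1 1 N"
proof -
  let ?x = "\<lambda>i. fps_const (monom 1 i) * fps_X :: int poly fps"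
  define A where "A = (\<Prod>i\<le>N. 1 - ?x i)"
  define B where "B = (\<Prod>i\<le>N. 1 + ?x i ^ 2)"
  define C where "C = (\<Prod>i\<le>N. 1 - ?x i ^ 4)"
  define D where "D = (\<Prod>i\<le>N. 1 + ?x i)"
  \<comment> \<open>Factor by factor, \<open>(1 - x) (1 + x^2) (1 + x) = 1 - x^4\<close> with
    \<open>x = z q^i\<close>.\<close>
  have "A * B * D = C"
    unfolding A_def B_def C_def D_def prod.distrib[symmetric]
    by (intro prod.cong refl) (simp add: algebra_simps power2_eq_square eval_nat_numeral)
  moreover have x_power: "?x i ^ d = fps_const (monom 1 (d * i)) * fps_X ^ d" for i d
    by (simp add: power_mult_distrib monom_power mult.commute)
  have "gauss_fps 1 1 1 N * A = 1"
    using gauss_fps_mult_prod[of 1 1 1 N] by (simp add: A_def)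
  moreover have "gauss_fps 2 (- 1) 2 N * B = 1"
    using gauss_fps_mult_prod[of 2 "-1" 2 N] unfolding B_def x_power
    by (simp flip: minus_monom fps_const_neg)
  moreover have "gauss_fps 4 1 4 N * C = 1"
    using gauss_fps_mult_prod[of 4 1 4 N] unfolding C_def x_power by simp
  moreover have "Abs_fps (elem_poly (Suc N)) = D"
    unfolding D_def Abs_fps_elem_poly by (simp only: lessThan_Suc_atMost)
  moreover have "G4 * D = G2 * G1"
    if "A * B * D = C" "G1 * A = 1" "G2 * B = 1" "G4 * C = 1" for G1 G2 G4 :: "int poly fps"
  proof -
    \<comment> \<open>Inserting two factors equal to 1 assembles \<open>A * B * D = C\<close>, which
      \<open>G4\<close> cancels.\<close>
    have "G4 * D = G4 * D * (G1 * A) * (G2 * B)" using that by simp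
    also have "\<dots> = G4 * (A * B * D) * (G2 * G1)" by (simp only: ac_simps)
    finally show ?thesis using that by simp
  qed
  ultimately show ?thesis by simp
qed

section \<open>Extraction of coefficients\<close>

lemma sum_multiples:
  fixes g :: "nat \<Rightarrow> 'a::comm_monoid_add"
  assumes "d > 0"
  shows "(\<Sum>i=0..k. if d dvd i then g i else 0) = (\<Sum>j=0..k div d. g (d * j))"
proof -
  have "(\<lambda>j. d * j) ` {0..k div d} = {i \<in> {0..k}. d dvd i}"
    using assms by (auto simp: image_iff dvd_def less_eq_div_iff_mult_less_eq mult.commute)
  moreover have "inj_on (\<lambda>j. d * j) {0..k div d}"
    using assms by (auto simp: inj_on_def)
  ultimately have "(\<Sum>j=0..k div d. g (d * j)) = sum g {i \<in> {0..k}. d dvd i}"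
    by (metis (no_types, lifting) sum.reindex_cong)
  then show ?thesis by (simp only: sum.inter_filter finite_atLeastAtMost)
qed

lemma gauss_fps_mult_nth:
  assumes "d > 0"
  shows "fps_nth (gauss_fps d c r N * f) k =
    (\<Sum>j=0..k div d. smult (c ^ j) (gauss_poly r N j * fps_nth f (k - d * j)))"
proof -
  have "fps_nth (gauss_fps d c r N * f) k = (\<Sum>i=0..k. if d dvd i
      then smult (c ^ (i div d)) (gauss_poly r N (i div d) * fps_nth f (k - i)) else 0)"
    unfolding fps_mult_nth by (intro sum.cong) (auto simp: gauss_fps_def)
  then show ?thesis using assms by (simp add: sum_multiples)
qed

theorem theorem3p3:
  fixes N k n :: nat
  shows "(\<Sum>j = 0..k div 4.
            int (pbar 4 (int N) (int N + 1 - int k + 4 * int j) (int j) (int k - 4 * int j)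
                   (int n - int ((k - 4 * j) choose 2))))
       = (\<Sum>j = 0..k div 2.
            (- 1) ^ j * int (pbar 2 (int N) (int N) (int j) (int k - 2 * int j) (int n)))"
    (is "?lhs = ?rhs")
proof -
  have "?lhs = (\<Sum>j=0..k div 4. coeff (gauss_poly 4 N j * elem_poly (Suc N) (k - 4 * j)) n)"
  proof (rule sum.cong)
    fix j assume "j \<in> {0..k div 4}"
    then have j: "4 * j \<le> k" by auto
    define m where "m = k - 4 * j"
    have m: "int k - 4 * int j = int m" "int N + 1 - int k + 4 * int j = int N + 1 - int m"
      using j by (auto simp: m_def)
    have "int (pbar 4 (int N) (int N + 1 - int m) (int j) (int m) (int n - int (m choose 2))) =
        coeff (gauss_poly 4 N j * elem_poly (Suc N) m) n"
    \<comment> \<open>If the case condition fails, an argument of \<open>pbar\<close> is negative.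
      Correspondingly \<open>elem_poly\<close> vanishes when \<open>m > Suc N\<close>, and its
      monomial pushes all exponents above \<open>n\<close> when
      \<open>(m choose 2) > n\<close>.\<close>
    proof (cases "m \<le> Suc N \<and> (m choose 2) \<le> n")
      case True
      then have eqs: "nat (int N + 1 - int m) = Suc N - m"
        "nat (int n - int (m choose 2)) = n - (m choose 2)" by auto
      have expand: "gauss_poly 4 N j * elem_poly (Suc N) m =
          monom 1 (m choose 2) * (gauss_poly 4 N j * gauss_poly 1 (Suc N - m) m)"
        using True by (simp add: elem_poly_def algebra_simps)
      show ?thesis
        unfolding expand using True by (simp add: pbar_def eqs card_two_kind_partitions coeff_monom_mult)
    next
      case False
      then show ?thesis
        by (auto simp: pbar_def elem_poly_def coeff_monom_mult mult.left_commute)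
    qed
    then show "int (pbar 4 (int N) (int N + 1 - int k + 4 * int j) (int j) (int k - 4 * int j)
          (int n - int ((k - 4 * j) choose 2))) =
        coeff (gauss_poly 4 N j * elem_poly (Suc N) (k - 4 * j)) n"
      unfolding m by (simp only: m_def)
  qed simp
  also have "\<dots> = coeff (fps_nth (gauss_fps 4 1 4 N * Abs_fps (elem_poly (Suc N))) k) n"
    by (simp add: gauss_fps_mult_nth coeff_sum)
  also have "\<dots> = coeff (fps_nth (gauss_fps 2 (- 1) 2 N * gauss_fps 1 1 1 N) k) n"
    by (simp only: elem_fps_mult_gauss_fps)
  \<comment> \<open>The factor with \<open>d = 1\<close> and \<open>c = 1\<close> has the plain
    \<open>gauss_poly 1 N\<close> as coefficients, since 1 divides every exponent.\<close>
  also have "\<dots> = (\<Sum>j=0..k div 2.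
      (- 1) ^ j * coeff (gauss_poly 2 N j * gauss_poly 1 N (k - 2 * j)) n)"
    by (simp add: gauss_fps_mult_nth coeff_sum) (simp add: gauss_fps_def)
  also have "\<dots> = ?rhs"
  proof (rule sum.cong)
    fix j assume "j \<in> {0..k div 2}"
    then have "int k - 2 * int j = int (k - 2 * j)" by auto
    then show "(- 1) ^ j * coeff (gauss_poly 2 N j * gauss_poly 1 N (k - 2 * j)) n =
        (- 1) ^ j * int (pbar 2 (int N) (int N) (int j) (int k - 2 * int j) (int n))"
      by (simp only: pbar_of_nat zero_less_numeral)
  qed simp
  finally show ?thesis .
qed

end
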